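(* Let $q$ be a real number with $q\ne 0,\pm1$, let $N$ be a positive integer, let $b$ be a nonzero real number that is not an integer power of $q$, and set $a=q^{1-N}$. Define the grid $x_s=q^{s+1}$ for $s=0,1,\dots,N-1$. For $0\le n\le N-1$ let $$P_n(x)=\frac{(a^{-1}bq^{1-n};q)_n(q;q)_n}{(q^{-n};q)_n(b;q)_n}\;{}_2\phi_1\!\left({q^{-n},\,b\atop a^{-1}bq^{1-n}};q,x\right)$$ be the Pastro polynomials, and let $R_n(x)$ be the Laurent polynomials $$R_n(x)=\frac{(q^{-n};q)_n(bq^{-1};q)_n}{(a^{-1}bq^{-n};q)_n(q;q)_n}\;{}_2\phi_1\!\left({q^{-n},\,ab^{-1}q\atop b^{-1}q^{2-n}};q,\frac{q^2}{ax}\right).$$ Then the biorthogonality relation $$\sum_{s=0}^{N-1} w_s\,P_n(x_s)\,R_m(x_s)=h_n\,\delta_{mn},\qquad m,n=0,1,\dots,N-1,$$ holds, where $$w_s=\frac{1}{(b;q)_{N-1}}\frac{(q^{1-N};q)_s}{(q;q)_s}(bq^{N-1})^s,\qquad h_n=\frac{(a;q)_n(q;q)_n}{(ab^{-1}q;q)_n(b;q)_n}.$$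
   Context: The $q$-Pochhammer symbol is $(z;q)_0=1$, $(z;q)_k=\prod_{i=0}^{k-1}(1-zq^i)$ for $k\ge1$. The terminating $q$-hypergeometric series is $${}_2\phi_1\!\left({q^{-n},\beta\atop \gamma};q,z\right)=\sum_{k=0}^{n}\frac{(q^{-n};q)_k(\beta;q)_k}{(\gamma;q)_k(q;q)_k}z^k .$$ $\delta_{mn}$ is the Kronecker delta. *)

theory Defs
  imports Complex_Main
begin

definition qpoch :: "real \<Rightarrow> real \<Rightarrow> nat \<Rightarrow> real" where
  "qpoch z q k = (\<Prod>i<k. 1 - z * q ^ i)"

text \<open>
  The terminating series with upper parameters \<open>q\<^sup>-\<^sup>n\<close> and \<open>\<beta>\<close> and lower
  parameter \<open>\<gamma>\<close>; the argument \<open>n\<close> stands for the upper parameter \<open>q\<^sup>-\<^sup>n\<close>.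
\<close>

definition phi21 :: "nat \<Rightarrow> real \<Rightarrow> real \<Rightarrow> real \<Rightarrow> real \<Rightarrow> real" where
  "phi21 n \<beta> \<gamma> q z =
     (\<Sum>k=0..n. qpoch (q powi (- int n)) q k * qpoch \<beta> q k / (qpoch \<gamma> q k * qpoch q q k) * z ^ k)"

definition pastro_P :: "real \<Rightarrow> real \<Rightarrow> real \<Rightarrow> nat \<Rightarrow> real \<Rightarrow> real" where
  "pastro_P a b q n x =
     qpoch (inverse a * b * q powi (1 - int n)) q n * qpoch q q n
       / (qpoch (q powi (- int n)) q n * qpoch b q n)
     * phi21 n b (inverse a * b * q powi (1 - int n)) q x"

definition pastro_R :: "real \<Rightarrow> real \<Rightarrow> real \<Rightarrow> nat \<Rightarrow> real \<Rightarrow> real" where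
  "pastro_R a b q n x =
     qpoch (q powi (- int n)) q n * qpoch (b * inverse q) q n
       / (qpoch (inverse a * b * q powi (- int n)) q n * qpoch q q n)
     * phi21 n (a * inverse b * q) (inverse b * q powi (2 - int n)) q (q ^ 2 / (a * x))"

definition pastro_grid :: "real \<Rightarrow> nat \<Rightarrow> real" where
  "pastro_grid q s = q ^ (s + 1)"

definition pastro_weight :: "nat \<Rightarrow> real \<Rightarrow> real \<Rightarrow> nat \<Rightarrow> real" where
  "pastro_weight N b q s =
     1 / qpoch b q (N - 1) * (qpoch (q powi (1 - int N)) q s / qpoch q q s)
     * (b * q powi (int N - 1)) ^ s"

definition pastro_norm :: "real \<Rightarrow> real \<Rightarrow> real \<Rightarrow> nat \<Rightarrow> real" where
  "pastro_norm a b q n =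
     qpoch a q n * qpoch q q n / (qpoch (a * inverse b * q) q n * qpoch b q n)"

end

theory Submission
  imports Defs
begin

text \<open>By the \<open>q\<close>-binomial theorem the moments of the weight are
  \<open>q\<^sup>e (bq\<^sup>e;q)\<^bsub>N-1\<^esub> / (b;q)\<^bsub>N-1\<^esub>\<close> for every integer \<open>e\<close>.
  Paired with \<open>x\<^sup>-\<^sup>j\<close>, \<open>j < n\<close>, the sum defining \<open>P\<^sub>n\<close> becomes, after cancelling \<open>q\<close>-Pochhammer symbols,
  \<open>\<Sum>\<^sub>k (q\<^sup>-\<^sup>n;q)\<^sub>k / (q;q)\<^sub>k q\<^sup>k f(q\<^sup>k)\<close> with \<open>f\<close> a polynomial of degree \<open>n - 1\<close>, and this
  vanishes, again by the \<open>q\<close>-binomial theorem; likewise \<open>R\<^sub>m\<close> annihilates \<open>x\<^sup>k\<close> for \<open>k < m\<close>.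
  Since \<open>P\<^sub>n\<close> is monic, the norm is \<open>R\<^sub>n\<close> paired with \<open>x\<^sup>n\<close>, where \<open>f\<close> acquires a single
  linear denominator and the sum is evaluated by partial fractions.\<close>

section \<open>Elementary properties of \<open>q\<close>-Pochhammer symbols\<close>

lemma power_int_add_nat:
  fixes q :: real
  assumes "q \<noteq> 0"
  shows "q powi (i + int n) = q powi i * q ^ n"
  using assms by (simp add: power_int_add)

lemma qpoch_0 [simp]: "qpoch z q 0 = 1"
  by (simp add: qpoch_def)

lemma qpoch_Suc: "qpoch z q (Suc k) = qpoch z q k * (1 - z * q ^ k)"
  by (simp add: qpoch_def)

lemma qpoch_Suc_shift: "qpoch z q (Suc k) = (1 - z) * qpoch (z * q) q k"
  unfolding qpoch_def by (subst prod.lessThan_Suc_shift) (simp add: mult.assoc)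

text \<open>Factor \<open>- z * q ^ i\<close> out of \<open>1 - z * q ^ i\<close>, leaving
  \<open>1 - q powi (- int i) / z\<close>, and run through the remaining factors backwards.\<close>

lemma qpoch_reverse:
  assumes "q \<noteq> 0" "z \<noteq> 0"
  shows "qpoch z q n = (- z) ^ n * (\<Prod>i<n. q ^ i) * qpoch (q powi (1 - int n) / z) q n"
proof -
  have "qpoch z q n = (\<Prod>i<n. (- z) * q ^ i * (1 - q powi (- int i) / z))"
    unfolding qpoch_def using assms
    by (intro prod.cong) (auto simp: field_simps power_int_minus)
  also have "\<dots> = (- z) ^ n * (\<Prod>i<n. q ^ i) * (\<Prod>i<n. 1 - q powi (- int i) / z)"
    by (simp only: prod.distrib prod_constant card_lessThan)
  also have "(\<Prod>i<n. 1 - q powi (- int i) / z) = (\<Prod>i<n. 1 - q powi (- int (n - Suc i)) / z)"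
    by (rule prod.nat_diff_reindex[symmetric])
  also have "\<dots> = qpoch (q powi (1 - int n) / z) q n"
    unfolding qpoch_def
  proof (intro prod.cong refl)
    fix i assume "i \<in> {..<n}"
    then have "- int (n - Suc i) = (1 - int n) + int i" by auto
    then have "q powi (- int (n - Suc i)) = q powi (1 - int n) * q ^ i"
      by (simp only: power_int_add_nat[OF assms(1)])
    then show "1 - q powi (- int (n - Suc i)) / z = 1 - q powi (1 - int n) / z * q ^ i"
      by simp
  qed
  finally show ?thesis .
qed

text \<open>The product is \<open>q\<close> to the power n(n-1)/2; squaring it avoids halving an
  exponent.\<close>

lemma prod_powers_squared:
  fixes q :: real
  shows "(\<Prod>i<n. q ^ i)\<^sup>2 * q ^ n = q ^ (n * n)"
proof (induction n)
  case (Suc n)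
  have "(\<Prod>i<Suc n. q ^ i)\<^sup>2 * q ^ Suc n = ((\<Prod>i<n. q ^ i)\<^sup>2 * q ^ n) * (q ^ n * q ^ Suc n)"
    by (simp add: power2_eq_square)
  also have "\<dots> = q ^ (n * n + (n + Suc n))"
    unfolding Suc.IH by (simp only: power_add)
  also have "n * n + (n + Suc n) = Suc n * Suc n" by simp
  finally show ?case .
qed simp

lemma real_power_neq_1:
  fixes q :: real
  assumes "q \<noteq> 1" "q \<noteq> - 1" "n > 0"
  shows "q ^ n \<noteq> 1"
proof
  assume "q ^ n = 1"
  then have "\<bar>q\<bar> ^ n = 1 ^ n" by (simp add: power_abs[symmetric])
  then have "\<bar>q\<bar> = 1" using assms power_eq_iff_eq_base[of n "\<bar>q\<bar>" 1] by simp
  then show False using assms by linarith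
qed

lemma qpoch_self_nonzero:
  assumes "q \<noteq> 1" "q \<noteq> - 1"
  shows "qpoch q q n \<noteq> 0"
  using real_power_neq_1[OF assms, of "Suc _"] by (auto simp: qpoch_def)

lemma qpoch_neg_power_nonzero:
  assumes "q \<noteq> 0" "q \<noteq> 1" "q \<noteq> - 1"
  shows "qpoch (q powi (- int n)) q n \<noteq> 0"
proof -
  have "q powi (1 - int n) / q = q powi (- int n)"
    using assms by (simp add: power_int_diff power_int_minus field_simps)
  then show ?thesis
    using qpoch_reverse[of q q n] qpoch_self_nonzero[of q n] assms by auto
qed

lemma qpoch_power_eq_0:
  assumes "q \<noteq> 0" "i < n"
  shows "qpoch (q powi (- int i)) q n = 0"
  using assms by (auto simp: qpoch_def power_int_minus intro!: bexI[of _ i])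

section \<open>The \<open>q\<close>-binomial theorem\<close>

text \<open>Up to sign and a power of \<open>q\<close> this is, for k \<le> n, the Gaussian binomial
  coefficient. It occurs in the weight and in both hypergeometric series.\<close>

definition qcoeff :: "real \<Rightarrow> nat \<Rightarrow> nat \<Rightarrow> real" where
  "qcoeff q n k = qpoch (q powi (- int n)) q k / qpoch q q k"

lemma qcoeff_0 [simp]: "qcoeff q n 0 = 1"
  by (simp add: qcoeff_def)

lemma qcoeff_Suc_self:
  assumes "q \<noteq> 0"
  shows "qcoeff q n (Suc n) = 0"
  using qpoch_power_eq_0[of q n "Suc n"] assms by (simp add: qcoeff_def)

text \<open>The \<open>q\<close>-Pascal rule. Over a common denominator it is
  \<open>1 - Q = (1 - Q * q ^ Suc k) - Q * (1 - q ^ Suc k)\<close>.\<close>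

lemma qcoeff_Suc_Suc:
  assumes q: "q \<noteq> 0" "q \<noteq> 1" "q \<noteq> - 1"
  shows "qcoeff q (Suc n) (Suc k) = qcoeff q n (Suc k) - q powi (- int (Suc n)) * qcoeff q n k"
proof -
  define Q where "Q = q powi (- int (Suc n))"
  have Q: "q powi (- int n) = Q * q"
    using q unfolding Q_def power_int_minus power_int_of_nat by (simp add: field_simps)
  define D where "D = qpoch q q k"
  define E where "E = qpoch (Q * q) q k"
  have D: "D \<noteq> 0" "1 - q * q ^ k \<noteq> 0"
    using qpoch_self_nonzero[of q "Suc k"] q by (auto simp: D_def qpoch_Suc)
  have "qcoeff q (Suc n) (Suc k) = (1 - Q) * E / (D * (1 - q * q ^ k))"
    unfolding qcoeff_def Q_def[symmetric] by (simp only: qpoch_Suc_shift[of Q] qpoch_Suc[of q] D_def E_def)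
  moreover have "qcoeff q n (Suc k) = E * (1 - Q * q * q ^ k) / (D * (1 - q * q ^ k))"
    unfolding qcoeff_def Q by (simp add: qpoch_Suc D_def E_def)
  moreover have "qcoeff q n k = E / D"
    unfolding qcoeff_def Q by (simp add: D_def E_def)
  moreover have "(1 - Q) * E / (D * (1 - q * q ^ k))
    = E * (1 - Q * q * q ^ k) / (D * (1 - q * q ^ k)) - Q * (E / D)"
  proof -
    have "Q * (E / D) = Q * E * (1 - q * q ^ k) / (D * (1 - q * q ^ k))"
      using D by simp
    then show ?thesis
      by (simp only: diff_divide_distrib[symmetric]) (simp add: algebra_simps)
  qed
  ultimately show ?thesis unfolding Q_def by simp
qed

text \<open>By the \<open>q\<close>-Pascal rule, passing from \<open>n\<close> to
  \<open>Suc n\<close> multiplies the sum by \<open>1 - z * q powi (- int (Suc n))\<close>, the new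
  first factor of the product.\<close>

lemma q_binomial:
  assumes q: "q \<noteq> 0" "q \<noteq> 1" "q \<noteq> - 1"
  shows "(\<Sum>k\<le>n. qcoeff q n k * z ^ k) = qpoch (z * q powi (- int n)) q n"
proof (induction n)
  case (Suc n)
  let ?Q = "q powi (- int (Suc n))"
  let ?S = "\<Sum>k\<le>n. qcoeff q n k * z ^ k"
  have "(\<Sum>k\<le>Suc n. qcoeff q (Suc n) k * z ^ k)
      = 1 + (\<Sum>k\<le>n. (qcoeff q n (Suc k) - ?Q * qcoeff q n k) * z ^ Suc k)"
    by (subst sum.atMost_Suc_shift) (simp only: qcoeff_Suc_Suc[OF q] qcoeff_0, simp)
  also have "\<dots> = (1 + (\<Sum>k\<le>n. qcoeff q n (Suc k) * z ^ Suc k)) - ?Q * z * ?S"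
    by (simp add: algebra_simps sum_subtractf sum_distrib_left)
  also have "1 + (\<Sum>k\<le>n. qcoeff q n (Suc k) * z ^ Suc k) = (\<Sum>k\<le>Suc n. qcoeff q n k * z ^ k)"
    by (subst sum.atMost_Suc_shift) simp
  also have "\<dots> = ?S"
    using qcoeff_Suc_self[OF q(1), of n] by simp
  also have "?S - ?Q * z * ?S = (1 - z * ?Q) * ?S"
    by (simp add: algebra_simps)
  also have "\<dots> = qpoch (z * ?Q) q (Suc n)"
  proof -
    have "z * ?Q * q = z * q powi (- int n)"
      using q unfolding power_int_minus power_int_of_nat by (simp add: field_simps)
    then show ?thesis by (simp only: qpoch_Suc_shift Suc.IH)
  qed
  finally show ?case .
qed simp

text \<open>At \<open>z = q ^ e\<close> the factor of index \<open>n - e\<close> in the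
  \<open>q\<close>-binomial product is zero; \<open>1 \<le> e\<close> puts this index below
  \<open>n\<close>.\<close>

lemma qcoeff_sum_eq_0:
  assumes q: "q \<noteq> 0" "q \<noteq> 1" "q \<noteq> - 1" and "1 \<le> e" "e \<le> n"
  shows "(\<Sum>k\<le>n. qcoeff q n k * (q ^ e) ^ k) = 0"
proof -
  have "q ^ e * q powi (- int n) = q powi (- int (n - e))"
    using assms by (simp add: of_nat_diff power_int_diff power_int_minus field_simps)
  then show ?thesis
    using qpoch_power_eq_0[of q "n - e" n] assms by (simp only: q_binomial[OF q]) simp
qed

section \<open>Sums against linear factors, and against one linear denominator\<close>

text \<open>Each linear factor combines exponents \<open>i\<close> and \<open>Suc i\<close> and so
  uses up one vanishing power sum; the exponents up to \<open>l\<close> are left over.\<close>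

lemma sum_times_linear_factors_eq_0:
  fixes A u :: "nat \<Rightarrow> real"
  assumes "\<And>i. i \<le> d + l \<Longrightarrow> (\<Sum>k\<in>S. A k * (y ^ i) ^ k) = 0" and "i \<le> l"
  shows "(\<Sum>k\<in>S. A k * (\<Prod>t<d. 1 - u t * y ^ k) * (y ^ i) ^ k) = 0"
  using assms
proof (induction d arbitrary: l i)
  case (Suc d)
  have "(\<Sum>k\<in>S. A k * (\<Prod>t<d. 1 - u t * y ^ k) * (y ^ j) ^ k) = 0" if "j \<le> Suc l" for j
    by (rule Suc.IH[of "Suc l"]) (use Suc.prems that in auto)
  from this[of i] this[of "Suc i"] Suc.prems
  have "(\<Sum>k\<in>S. A k * (\<Prod>t<d. 1 - u t * y ^ k) * (y ^ i) ^ k)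
      - u d * (\<Sum>k\<in>S. A k * (\<Prod>t<d. 1 - u t * y ^ k) * (y ^ Suc i) ^ k) = 0"
    by simp
  then show ?case
    by (simp add: sum_distrib_left sum_subtractf[symmetric] algebra_simps power_mult_distrib)
qed simp

lemma sum_times_qpoch_eq_0:
  fixes A :: "nat \<Rightarrow> real"
  assumes "\<And>i. i \<le> d + l \<Longrightarrow> (\<Sum>k\<in>S. A k * (y ^ i) ^ k) = 0" and "i \<le> l"
  shows "(\<Sum>k\<in>S. A k * qpoch (v * y ^ k) q d * (y ^ i) ^ k) = 0"
  using sum_times_linear_factors_eq_0[OF assms, where u = "\<lambda>t. v * q ^ t"]
  by (simp add: qpoch_def mult_ac)

text \<open>The first symbol leaves the exponents up to \<open>l\<close>, exactly what the
  \<open>l\<close> factors of the second consume.\<close>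

lemma sum_times_two_qpoch_eq_0:
  fixes A :: "nat \<Rightarrow> real"
  assumes "\<And>i. i \<le> d + l \<Longrightarrow> (\<Sum>k\<in>S. A k * (y ^ i) ^ k) = 0"
  shows "(\<Sum>k\<in>S. A k * qpoch (v * y ^ k) q d * qpoch (w * y ^ k) q l) = 0"
proof -
  have "(\<Sum>k\<in>S. A k * qpoch (v * y ^ k) q d * (y ^ i) ^ k) = 0" if "i \<le> l" for i
    by (rule sum_times_qpoch_eq_0[OF assms that])
  then show ?thesis
    using sum_times_qpoch_eq_0[where d = l and l = 0 and i = 0 and v = w and y = y and S = S and q = q
        and A = "\<lambda>k. A k * qpoch (v * y ^ k) q d"] by simp
qed

text \<open>Dividing one factor by \<open>1 - c * y ^ k\<close> gives \<open>u d / c\<close> plus a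
  multiple of the reciprocal. The constant part meets a vanishing sum, so each factor is replaced by
  its value at the pole \<open>1 / c\<close>.\<close>

lemma sum_linear_factors_over_linear:
  fixes A u :: "nat \<Rightarrow> real"
  assumes "\<And>i. i < d \<Longrightarrow> (\<Sum>k\<in>S. A k * (y ^ i) ^ k) = 0"
    and c: "c \<noteq> 0" and "\<And>k. 1 - c * y ^ k \<noteq> 0"
  shows "(\<Sum>k\<in>S. A k * (\<Prod>t<d. 1 - u t * y ^ k) / (1 - c * y ^ k))
    = (\<Prod>t<d. 1 - u t / c) * (\<Sum>k\<in>S. A k / (1 - c * y ^ k))"
  using assms(1)
proof (induction d)
  case (Suc d)
  let ?p = "\<lambda>k. A k * (\<Prod>t<d. 1 - u t * y ^ k)"
  have 0: "(\<Sum>k\<in>S. ?p k) = 0"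
    using sum_times_linear_factors_eq_0[where d = d and l = 0 and S = S and A = A and y = y and i = 0] Suc.prems by simp
  have "?p k * (1 - u d * y ^ k) / (1 - c * y ^ k)
      = u d / c * ?p k + (1 - u d / c) * (?p k / (1 - c * y ^ k))" for k
  proof -
    have "(1 - u d * y ^ k) / (1 - c * y ^ k) = u d / c + (1 - u d / c) / (1 - c * y ^ k)"
      using c assms(3)[of k] by (simp add: divide_simps) (simp add: algebra_simps)
    then have "?p k * ((1 - u d * y ^ k) / (1 - c * y ^ k))
      = ?p k * (u d / c + (1 - u d / c) / (1 - c * y ^ k))" by simp
    then show ?thesis by (simp add: algebra_simps)
  qed
  then have "(\<Sum>k\<in>S. A k * (\<Prod>t<Suc d. 1 - u t * y ^ k) / (1 - c * y ^ k))
     = u d / c * (\<Sum>k\<in>S. ?p k) + (1 - u d / c) * (\<Sum>k\<in>S. ?p k / (1 - c * y ^ k))"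
    by (simp add: mult.assoc sum.distrib sum_distrib_left)
  then show ?case using 0 Suc by (simp add: mult_ac)
qed simp

section \<open>Symbols of base \<open>b\<close> with integer index\<close>

text \<open>Every \<open>qpoch (b * q powi i) q n\<close> is a quotient of two values of \<open>qpochi\<close>, which reduces the
  cancellation of products over overlapping index ranges to field arithmetic.\<close>

definition qpochi :: "real \<Rightarrow> real \<Rightarrow> int \<Rightarrow> real" where
  "qpochi b q i = (if i \<ge> 0 then qpoch b q (nat i) else inverse (qpoch (b * q powi i) q (nat (- i))))"

lemma qpochi_0 [simp]: "qpochi b q 0 = 1"
  by (simp add: qpochi_def)

context
  fixes q b :: real
  assumes q: "q \<noteq> 0" "q \<noteq> 1" "q \<noteq> - 1"
    and b: "b \<noteq> 0" "\<And>k :: int. b \<noteq> q powi k"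
begin

lemma factor_nonzero: "1 - b * q powi i \<noteq> 0"
proof
  assume "1 - b * q powi i = 0"
  then have "b = q powi (- i)" using q by (simp add: power_int_minus field_simps)
  then show False using b by blast
qed

lemma qpoch_shift_nonzero: "qpoch (b * q powi i) q n \<noteq> 0"
proof -
  have "1 - b * q powi i * q ^ k \<noteq> 0" for k
    using factor_nonzero[of "i + int k"] by (simp only: power_int_add_nat[OF q(1)] mult.assoc not_False_eq_True)
  then show ?thesis by (simp add: qpoch_def)
qed

lemma qpochi_nonzero: "qpochi b q i \<noteq> 0"
  using qpoch_shift_nonzero[of 0] qpoch_shift_nonzero[of i] by (auto simp: qpochi_def)

text \<open>The recurrence persists across index 0, so \<open>qpoch_eq_qpochi\<close> follows by
  telescoping.\<close>

lemma qpochi_add_1: "qpochi b q (i + 1) = qpochi b q i * (1 - b * q powi i)"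
proof (cases "i \<ge> 0")
  case True
  then show ?thesis
    by (auto simp: qpochi_def nat_add_distrib qpoch_Suc power_int_def)
next
  case False
  define n where "n = nat (- 1 - i)"
  have n: "nat (- i) = Suc n" "nat (- 1 - i) = n" "nat (- i - 1) = n"
    using False by (auto simp: n_def)
  have "qpoch (b * q powi i) q (Suc n) = (1 - b * q powi i) * qpoch (b * q powi (i + 1)) q n"
    using q by (simp add: qpoch_Suc_shift power_int_add mult.assoc)
  \<comment> \<open>For \<open>i = -1\<close> the index \<open>i + 1\<close> is 0, so its value
    comes from the nonnegative branch.\<close>
  moreover have "qpochi b q (i + 1) = inverse (qpoch (b * q powi (i + 1)) q n)"
    using False n by (cases "i = -1") (auto simp: qpochi_def)
  ultimately show ?thesis
    using False factor_nonzero[of i] by (simp add: qpochi_def n)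
qed

lemma qpoch_eq_qpochi: "qpoch (b * q powi i) q n = qpochi b q (i + int n) / qpochi b q i"
proof (induction n)
  case (Suc n)
  have "i + int (Suc n) = (i + int n) + 1" by simp
  then have "qpochi b q (i + int (Suc n)) = qpochi b q (i + int n) * (1 - b * q powi (i + int n))"
    by (simp only: qpochi_add_1)
  then show ?case using q by (simp add: qpoch_Suc Suc.IH power_int_add_nat mult.assoc)
qed (simp add: qpochi_nonzero)

text \<open>The parameters of \<open>R_n\<close> carry \<open>b\<close> in the denominator; reversal
  brings them to base \<open>b\<close>, where they can cancel against the moments.\<close>

lemma qpoch_inverse_eq_qpochi:
  "qpoch (q powi e / b) q n
     = (- 1 / b) ^ n * (\<Prod>i<n. q ^ i) * (q powi e) ^ n * qpochi b q (1 - e) / qpochi b q (1 - e - int n)"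
proof -
  have z: "q powi (1 - int n) / (q powi e / b) = b * q powi (1 - e - int n)"
  proof -
    have "1 - e - int n = (1 - int n) - e" by simp
    then have "q powi (1 - e - int n) = q powi (1 - int n) / q powi e"
      using q by (simp only: power_int_diff simp_thms)
    then show ?thesis by simp
  qed
  have "(- (q powi e / b)) ^ n = (- 1 / b) ^ n * (q powi e) ^ n"
    by (simp add: power_mult_distrib[symmetric])
  moreover have "qpoch (q powi e / b) q n
      = (- (q powi e / b)) ^ n * (\<Prod>i<n. q ^ i) * qpoch (b * q powi (1 - e - int n)) q n"
    using qpoch_reverse[of q "q powi e / b" n] q b by (simp only: z) simp
  ultimately show ?thesis
    by (simp add: qpoch_eq_qpochi)
qed

lemma qpoch_inverse_nonzero: "qpoch (q powi e / b) q n \<noteq> 0"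
  using q b by (simp add: qpoch_inverse_eq_qpochi qpochi_nonzero)

text \<open>Reversal contributes \<open>(- 1 / b) ^ n\<close> and the product of the
  \<open>q ^ i\<close>, both independent of the exponents \<open>e\<close> and \<open>f\<close>, so
  they drop out.\<close>

lemma qpoch_inverse_quotient:
  "qpoch (q powi e / b) q n / qpoch (q powi f / b) q n
     = (q powi (e - f)) ^ n * (qpochi b q (1 - e) * qpochi b q (1 - f - int n))
        / (qpochi b q (1 - e - int n) * qpochi b q (1 - f))"
proof -
  have nz: "(- 1 / b) ^ n * (\<Prod>i<n. q ^ i) \<noteq> 0" using q b by simp
  have "q powi (e - f) = q powi e / q powi f"
    using q(1) by (simp add: power_int_diff)
  then have "(q powi (e - f)) ^ n = (q powi e) ^ n / (q powi f) ^ n"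
    by (simp only: power_divide)
  moreover have cancel: "(K * x * u / v) / (K * y * u' / v') = x / y * (u * v') / (v * u')"
    if "K \<noteq> 0" for K x y u v u' v' :: real
    using that by simp
  ultimately show ?thesis
    unfolding qpoch_inverse_eq_qpochi by (simp only: cancel[OF nz])
qed

section \<open>Moments of the weight\<close>

text \<open>Here \<open>Suc M\<close> is \<open>N\<close>, so the weight contains
  \<open>qcoeff q M s\<close>. The grid power is geometric in \<open>s\<close>, which gives the
  \<open>q\<close>-binomial sum at \<open>z = b * q powi (int M + e)\<close>.\<close>

lemma moment:
  "(\<Sum>s<Suc M. pastro_weight (Suc M) b q s * pastro_grid q s powi e)
     = q powi e * qpoch (b * q powi e) q M / qpoch b q M"
proof -
  have "pastro_weight (Suc M) b q s * pastro_grid q s powi e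
      = q powi e / qpoch b q M * (qcoeff q M s * (b * q powi (int M + e)) ^ s)" for s
  proof -
    have "pastro_grid q s powi e = (q powi int (s + 1)) powi e"
      by (simp only: pastro_grid_def power_int_of_nat)
    also have "\<dots> = q powi (e + e * int s)"
      by (simp only: power_int_mult[symmetric]) (simp add: algebra_simps)
    also have "\<dots> = q powi e * (q powi e) ^ s"
      using q by (simp add: power_int_add power_int_mult)
    finally show ?thesis
      using q by (simp add: pastro_weight_def qcoeff_def power_int_add power_mult_distrib)
  qed
  then have "(\<Sum>s<Suc M. pastro_weight (Suc M) b q s * pastro_grid q s powi e)
     = q powi e / qpoch b q M * (\<Sum>s\<le>M. qcoeff q M s * (b * q powi (int M + e)) ^ s)"
    by (simp only: sum_distrib_left lessThan_Suc_atMost)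
  also have "\<dots> = q powi e / qpoch b q M * qpoch (b * q powi (int M + e) * q powi (- int M)) q M"
    by (simp only: q_binomial[OF q])
  also have "b * q powi (int M + e) * q powi (- int M) = b * q powi e"
    using q by (simp add: power_int_add power_int_minus)
  finally show ?thesis by simp
qed

section \<open>Orthogonality of both families to powers of \<open>x\<close>\<close>

text \<open>With \<open>F = qpochi b q\<close> the symbols combine into
  \<open>F k / F (k - j)\<close> and \<open>F (M + k - j) / F (1 + M - n + k)\<close>, polynomials
  in \<open>q ^ k\<close> of degrees \<open>j\<close> and \<open>n - 1 - j\<close>.\<close>

lemma P_coeff_orthogonal:
  assumes "n \<le> M" "j < n"
  shows "(\<Sum>k\<le>n. qcoeff q n k * qpoch b q k / qpoch (b * q powi (1 + int M - int n)) q k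
            * (q powi (int k - int j) * qpoch (b * q powi (int k - int j)) q M)) = 0"
    (is "(\<Sum>k\<le>n. ?f k) = 0")
proof -
  let ?A = "\<lambda>k. qcoeff q n k * q ^ k"
  let ?g = "\<lambda>k. ?A k * qpoch (b * q powi (- int j) * q ^ k) q j
    * qpoch (b * q powi (1 + int M - int n) * q ^ k) q (n - 1 - j)"
  let ?K = "q powi (- int j) * qpochi b q (1 + int M - int n)"
  have f: "?f k = ?K * ?g k" for k
  proof -
    have shift: "q powi (int k - int j) = q powi (- int j) * q ^ k"
      using power_int_add_nat[of q "- int j" k] q by simp
    have "qpoch b q k = qpochi b q (int k)"
      using qpoch_eq_qpochi[of 0 k] by simp
    moreover have "qpoch (b * q powi (- int j) * q ^ k) q j = qpochi b q (int k) / qpochi b q (int k - int j)"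
      using qpoch_eq_qpochi[of "int k - int j" j] by (simp add: shift mult.assoc)
    moreover have "qpoch (b * q powi (1 + int M - int n) * q ^ k) q (n - 1 - j)
        = qpochi b q (int k - int j + int M) / qpochi b q (1 + int M - int n + int k)"
    proof -
      have "1 + int M - int n + int k + int (n - 1 - j) = int k - int j + int M"
        using assms by simp
      then show ?thesis
        using qpoch_eq_qpochi[of "1 + int M - int n + int k" "n - 1 - j"]
        by (simp only: power_int_add_nat[OF q(1)] mult.assoc)
    qed
    ultimately show ?thesis
      using shift qpoch_eq_qpochi[of "int k - int j" M]
        qpoch_eq_qpochi[of "1 + int M - int n" k]
      by (simp add: qpochi_nonzero mult_ac)
  qed
  have "(\<Sum>k\<le>n. ?g k) = 0"
  proof (rule sum_times_two_qpoch_eq_0)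
    \<comment> \<open>The factor \<open>q ^ k\<close> in \<open>?A\<close> moves the exponents from
      0..n-1 to 1..n, the range of \<open>qcoeff_sum_eq_0\<close>.\<close>
    fix i assume "i \<le> j + (n - 1 - j)"
    then show "(\<Sum>k\<le>n. ?A k * (q ^ i) ^ k) = 0"
      using qcoeff_sum_eq_0[OF q, of "Suc i" n] assms by (simp add: power_mult_distrib mult.assoc)
  qed
  then show ?thesis by (simp only: f sum_distrib_left[symmetric] mult_zero_right)
qed

text \<open>One term of the series of \<open>R_m\<close> paired with \<open>x ^ k\<close>: the
  coefficient of \<open>x powi (- int j)\<close> times the moment of exponent \<open>k - j\<close>,
  without the common divisor \<open>qpoch b q M\<close>. For \<open>a = q powi (- int M)\<close> the
  power \<open>q ^ (M + 2)\<close> is \<open>q ^ 2 / a\<close>.\<close>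

definition R_summand :: "nat \<Rightarrow> nat \<Rightarrow> nat \<Rightarrow> nat \<Rightarrow> real" where
  "R_summand M m k j = qcoeff q m j * qpoch (q powi (1 - int M) / b) q j / qpoch (q powi (2 - int m) / b) q j
     * (q ^ (M + 2)) ^ j * (q powi (int k - int j) * qpoch (b * q powi (int k - int j)) q M)"

text \<open>The powers of \<open>q\<close> collapse to \<open>q ^ k * (q ^ m) ^ j\<close>. The
  indices of \<open>qpochi\<close> fall with \<open>j\<close>, so the natural variable is
  \<open>inverse q ^ j\<close>.\<close>

lemma R_summand_eq:
  "R_summand M m k j = q ^ k * qpochi b q (int M) / qpochi b q (int m - 1)
     * (qcoeff q m j * (q ^ m) ^ j
        * (qpochi b q (int m - 1 - int j) * qpochi b q (int M + int k - int j)
           / (qpochi b q (int M - int j) * qpochi b q (int k - int j))))"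
proof -
  have 1: "qpoch (q powi (1 - int M) / b) q j / qpoch (q powi (2 - int m) / b) q j
    = (q powi (int m - 1 - int M)) ^ j * (qpochi b q (int M) * qpochi b q (int m - 1 - int j))
        / (qpochi b q (int M - int j) * qpochi b q (int m - 1))"
    unfolding qpoch_inverse_quotient by (simp add: algebra_simps)
  have 2: "qpoch (b * q powi (int k - int j)) q M = qpochi b q (int M + int k - int j) / qpochi b q (int k - int j)"
    unfolding qpoch_eq_qpochi by (simp add: algebra_simps)
  have 3: "(q powi (int m - 1 - int M)) ^ j * (q ^ (M + 2)) ^ j * q powi (int k - int j) = q ^ k * (q ^ m) ^ j"
  proof -
    have "int m - 1 - int M + int (M + 2) = 1 + int m" by simp
    then have "q powi (int m - 1 - int M) * q ^ (M + 2) = q powi (1 + int m)"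
      by (simp only: power_int_add_nat[OF q(1), symmetric])
    then have "q powi (int m - 1 - int M) * q ^ (M + 2) = q * q ^ m"
      by (simp only: power_int_add_nat[OF q(1)] power_int_1_right)
    then have "(q powi (int m - 1 - int M)) ^ j * (q ^ (M + 2)) ^ j = q ^ j * (q ^ m) ^ j"
      by (simp only: power_mult_distrib[symmetric])
    moreover have "q powi (int k - int j) = q ^ k / q ^ j"
      using q(1) by (simp add: power_int_diff)
    ultimately show ?thesis using q(1) by simp
  qed
  have "R_summand M m k j = qcoeff q m j
     * (qpoch (q powi (1 - int M) / b) q j / qpoch (q powi (2 - int m) / b) q j)
     * (q ^ (M + 2)) ^ j * (q powi (int k - int j) * qpoch (b * q powi (int k - int j)) q M)"
    by (simp add: R_summand_def)
  also have "\<dots> = qcoeff q m j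
     * ((q powi (int m - 1 - int M)) ^ j * (q ^ (M + 2)) ^ j * q powi (int k - int j))
     * (qpochi b q (int M) * qpochi b q (int m - 1 - int j) * qpochi b q (int M + int k - int j)
        / (qpochi b q (int M - int j) * qpochi b q (int m - 1) * qpochi b q (int k - int j)))"
    unfolding 1 2 by (simp only: times_divide_eq_left times_divide_eq_right divide_divide_eq_left mult_ac)
  finally show ?thesis
    unfolding 3 by (simp only: times_divide_eq_left times_divide_eq_right divide_divide_eq_left mult_ac)
qed

text \<open>The weight \<open>(q ^ m) ^ j\<close> turns exponent \<open>i\<close> of
  \<open>inverse q ^ j\<close> into exponent \<open>m - i\<close> of \<open>q ^ j\<close>, which
  lies in 1..m.\<close>

lemma qcoeff_weighted_sum_eq_0:
  assumes "i < m"
  shows "(\<Sum>j\<le>m. qcoeff q m j * (q ^ m) ^ j * ((inverse q) ^ i) ^ j) = 0"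
proof -
  have "q ^ m * inverse q ^ i = q ^ (m - i)"
    using assms q by (simp add: power_diff field_simps)
  then show ?thesis
    using qcoeff_sum_eq_0[OF q, of "m - i" m] assms
    by (simp add: mult.assoc power_mult_distrib[symmetric])
qed

lemma power_int_diff_nat: "q powi (i - int j) = q powi i * (inverse q) ^ j"
  using q by (simp add: power_int_diff field_simps)

text \<open>With \<open>F = qpochi b q\<close>, the quotients
  \<open>F (M + k - j) / F (M - j)\<close> and \<open>F (m - 1 - j) / F (k - j)\<close> are
  polynomials in \<open>inverse q ^ j\<close> of degrees \<open>k\<close> and
  \<open>m - 1 - k\<close>.\<close>

lemma R_coeff_orthogonal:
  assumes "k < m"
  shows "(\<Sum>j\<le>m. R_summand M m k j) = 0"
proof -
  let ?A = "\<lambda>j. qcoeff q m j * (q ^ m) ^ j"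
  let ?g = "\<lambda>j. ?A j * qpoch (b * q powi int M * (inverse q) ^ j) q k
    * qpoch (b * q powi int k * (inverse q) ^ j) q (m - 1 - k)"
  let ?K = "q ^ k * qpochi b q (int M) / qpochi b q (int m - 1)"
  have f: "R_summand M m k j = ?K * ?g j" for j
  proof -
    have "qpoch (b * q powi int M * (inverse q) ^ j) q k
        = qpochi b q (int M + int k - int j) / qpochi b q (int M - int j)"
      using qpoch_eq_qpochi[of "int M - int j" k]
      by (simp add: power_int_diff_nat mult.assoc algebra_simps)
    moreover have "qpoch (b * q powi int k * (inverse q) ^ j) q (m - 1 - k)
        = qpochi b q (int m - 1 - int j) / qpochi b q (int k - int j)"
    proof -
      have "int k - int j + int (m - 1 - k) = int m - 1 - int j"
        using assms by simp
      then show ?thesis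
        using qpoch_eq_qpochi[of "int k - int j" "m - 1 - k"]
        by (simp only: power_int_diff_nat mult.assoc)
    qed
    ultimately show ?thesis
      unfolding R_summand_eq by simp
  qed
  have "(\<Sum>j\<le>m. ?g j) = 0"
    by (rule sum_times_two_qpoch_eq_0, rule qcoeff_weighted_sum_eq_0) (use assms in auto)
  then show ?thesis by (simp only: f sum_distrib_left[symmetric] mult_zero_right)
qed

section \<open>Evaluation of the norm\<close>

text \<open>Choosing the numerator zeros at the first \<open>m\<close> nodes leaves only the last summand.\<close>

lemma qcoeff_partial_fractions:
  "qpoch (q powi (1 - int m) / b) q m
     * (\<Sum>j\<le>m. qcoeff q m j * (q ^ m) ^ j / (1 - b * q powi (int m - 1) * (inverse q) ^ j))
   = qcoeff q m m * (q ^ m) ^ m * qpoch (q powi (- int m)) q m / (1 - b / q)"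
proof -
  define c where "c = b * q powi (int m - 1)"
  let ?A = "\<lambda>j. qcoeff q m j * (q ^ m) ^ j"
  have c: "c \<noteq> 0" using q b by (simp add: c_def)
  have nz: "1 - c * (inverse q) ^ j \<noteq> 0" for j
    using factor_nonzero[of "int m - 1 - int j"] unfolding c_def
    by (simp only: power_int_diff_nat[of "int m - 1"] mult.assoc not_False_eq_True)
  have "(\<Prod>t<m. 1 - q ^ t / c) = qpoch (q powi (1 - int m) / b) q m"
  proof -
    have "1 / c = q powi (1 - int m) / b"
      using q b by (simp add: c_def power_int_diff)
    then have "q ^ t / c = q powi (1 - int m) / b * q ^ t" for t
      by (metis mult.commute times_divide_eq_left mult_1 times_divide_eq_right)
    then show ?thesis by (simp only: qpoch_def)
  qed
  \<comment> \<open>\<open>sum_linear_factors_over_linear\<close> is read from right to left, to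
    evaluate the sum of reciprocals through a numerator known at every node
    \<open>inverse q ^ j\<close>.\<close>
  then have "qpoch (q powi (1 - int m) / b) q m * (\<Sum>j\<le>m. ?A j / (1 - c * (inverse q) ^ j))
     = (\<Sum>j\<le>m. ?A j * (\<Prod>t<m. 1 - q ^ t * (inverse q) ^ j) / (1 - c * (inverse q) ^ j))"
    using sum_linear_factors_over_linear[OF qcoeff_weighted_sum_eq_0 c nz, of m, where u = "\<lambda>t. q ^ t"] by simp
  also have "\<dots> = ?A m * (\<Prod>t<m. 1 - q ^ t * (inverse q) ^ m) / (1 - c * (inverse q) ^ m)"
  proof -
    have "(\<Prod>t<m. 1 - q ^ t * (inverse q) ^ j) = 0" if "j < m" for j
      using that q by (auto intro!: bexI[of _ j] simp: power_inverse)
    then have "(\<Sum>j<m. ?A j * (\<Prod>t<m. 1 - q ^ t * (inverse q) ^ j) / (1 - c * (inverse q) ^ j)) = 0"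
      by (intro sum.neutral) auto
    then show ?thesis
      by (simp only: lessThan_Suc_atMost[symmetric] sum.lessThan_Suc)
  qed
  also have "(\<Prod>t<m. 1 - q ^ t * (inverse q) ^ m) = qpoch (q powi (- int m)) q m"
    using q by (simp add: qpoch_def power_int_minus power_inverse mult.commute)
  also have "c * (inverse q) ^ m = b / q"
    using q by (simp add: c_def power_int_diff power_inverse)
  finally show ?thesis unfolding c_def .
qed

text \<open>At \<open>k = m\<close> the quotient \<open>F (m - 1 - j) / F (m - j)\<close> with
  \<open>F = qpochi b q\<close> is the reciprocal of \<open>1 - c * inverse q ^ j\<close>, and the
  other quotient has degree \<open>m\<close>. The sum is thus the numerator at the pole times the
  sum in \<open>qcoeff_partial_fractions\<close>.\<close>

lemma R_coeff_norm:
  assumes "m \<le> M"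
  shows "(\<Sum>j\<le>m. R_summand M m m j) = q ^ m * qpochi b q (int M) / qpochi b q (int m - 1)
     * (qpoch (q powi (1 + int M - int m)) q m
        * (qcoeff q m m * (q ^ m) ^ m * qpoch (q powi (- int m)) q m / (1 - b / q))
        / qpoch (q powi (1 - int m) / b) q m)"
proof -
  define c where "c = b * q powi (int m - 1)"
  define u where "u t = b * q powi int M * q ^ t" for t
  let ?A = "\<lambda>j. qcoeff q m j * (q ^ m) ^ j"
  let ?K = "q ^ m * qpochi b q (int M) / qpochi b q (int m - 1)"
  have c: "c \<noteq> 0" using q b by (simp add: c_def)
  have nz: "1 - c * (inverse q) ^ j \<noteq> 0" for j
    using factor_nonzero[of "int m - 1 - int j"] unfolding c_def
    by (simp only: power_int_diff_nat[of "int m - 1"] mult.assoc not_False_eq_True)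
  have f: "R_summand M m m j = ?K * (?A j * (\<Prod>t<m. 1 - u t * (inverse q) ^ j) / (1 - c * (inverse q) ^ j))" for j
  proof -
    have "(\<Prod>t<m. 1 - u t * (inverse q) ^ j) = qpoch (b * q powi (int M - int j)) q m"
      by (simp only: qpoch_def u_def power_int_diff_nat mult_ac)
    also have "\<dots> = qpochi b q (int M + int m - int j) / qpochi b q (int M - int j)"
      unfolding qpoch_eq_qpochi by (simp add: algebra_simps)
    finally have 1: "(\<Prod>t<m. 1 - u t * (inverse q) ^ j)
      = qpochi b q (int M + int m - int j) / qpochi b q (int M - int j)" .
    have "int m - int j = (int m - 1 - int j) + 1" by simp
    then have "qpochi b q (int m - int j) = qpochi b q (int m - 1 - int j) * (1 - b * q powi (int m - 1 - int j))"
      by (simp only: qpochi_add_1)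
    then have 2: "qpochi b q (int m - int j) = qpochi b q (int m - 1 - int j) * (1 - c * (inverse q) ^ j)"
      by (simp only: power_int_diff_nat[of "int m - 1"] c_def mult.assoc)
    show ?thesis
      unfolding R_summand_eq 1 2 using qpochi_nonzero by simp
  qed
  have "(\<Sum>j\<le>m. R_summand M m m j)
    = ?K * ((\<Prod>t<m. 1 - u t / c) * (\<Sum>j\<le>m. ?A j / (1 - c * (inverse q) ^ j)))"
    unfolding f sum_distrib_left[symmetric]
    by (subst sum_linear_factors_over_linear[OF qcoeff_weighted_sum_eq_0 c nz]) auto
  \<comment> \<open>At the pole \<open>b\<close> cancels from \<open>u t / c\<close>, so the value
    of the numerator is free of \<open>b\<close>.\<close>
  also have "(\<Prod>t<m. 1 - u t / c) = qpoch (q powi (1 + int M - int m)) q m"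
  proof -
    have "1 + int M - int m = int M - (int m - 1)" by simp
    then have "q powi (1 + int M - int m) = q powi int M / q powi (int m - 1)"
      by (simp only: power_int_diff[OF disjI1[OF q(1)]])
    then have "b * q powi int M / c = q powi (1 + int M - int m)"
      using b by (simp add: c_def)
    then have "u t / c = q powi (1 + int M - int m) * q ^ t" for t
      by (metis u_def times_divide_eq_left)
    then show ?thesis by (simp only: qpoch_def)
  qed
  also have "(\<Sum>j\<le>m. ?A j / (1 - c * (inverse q) ^ j))
    = qcoeff q m m * (q ^ m) ^ m * qpoch (q powi (- int m)) q m / (1 - b / q) / qpoch (q powi (1 - int m) / b) q m"
    unfolding qcoeff_partial_fractions[of m, symmetric] c_def
    by (rule nonzero_mult_div_cancel_left[OF qpoch_inverse_nonzero, symmetric])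
  finally show ?thesis by (simp only: times_divide_eq_right)
qed

text \<open>Reversal expresses the symbols through \<open>Y\<close>, \<open>V\<close>,
  \<open>W\<close>, \<open>Z\<close>, up to the sign \<open>s\<close> and the powers in
  \<open>T\<close> and \<open>L\<close>; field arithmetic does the rest.\<close>

lemma R_norm:
  assumes "m \<le> M"
  shows "qpoch (q powi (- int m)) q m * qpoch (b * inverse q) q m
       / (qpoch (b * q powi (int M - int m)) q m * qpoch q q m)
       * (\<Sum>j\<le>m. R_summand M m m j) / qpoch b q M
     = pastro_norm (q powi (- int M)) b q m"
proof -
  define T where "T = (\<Prod>i<m. q ^ i)"
  define s :: real where "s = (- 1) ^ m"
  define L where "L = (q powi (int M - int m)) ^ m"
  define X where "X = qpoch q q m"
  define Y where "Y = qpoch (q powi (- int m)) q m"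
  define V where "V = qpoch (q powi (1 - int m) / b) q m"
  define W where "W = qpoch (q powi (1 - int M) / b) q m"
  define Z where "Z = qpoch (q powi (- int M)) q m"
  have s: "s * s = 1" "s \<noteq> 0" by (auto simp: s_def simp flip: power_mult_distrib)
  have nz: "T \<noteq> 0" "L \<noteq> 0" "Y \<noteq> 0" "V \<noteq> 0" "W \<noteq> 0"
    using q qpoch_neg_power_nonzero[OF q] qpoch_inverse_nonzero
    by (auto simp: T_def L_def Y_def V_def W_def)
  have neg: "(- x) ^ m = s * x ^ m" for x :: real
    unfolding s_def by (rule power_minus)
  have X: "X = s * q ^ m * T * Y"
  proof -
    have "q powi (1 - int m) / q = q powi (- int m)"
      using q by (simp add: power_int_diff power_int_minus field_simps)
    then show ?thesis
      using qpoch_reverse[of q q m] q by (simp add: X_def Y_def T_def neg)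
  qed
  have B: "qpoch b q m = s * b ^ m * T * V"
    using qpoch_reverse[of q b m] q b by (simp add: V_def T_def neg)
  have D: "qpoch (b * q powi (int M - int m)) q m = s * b ^ m * L * T * W"
  proof -
    have "q powi (1 - int M) = q powi (1 - int m) / q powi (int M - int m)"
      using q by (simp add: power_int_diff)
    then have "q powi (1 - int m) / (b * q powi (int M - int m)) = q powi (1 - int M) / b"
      by simp
    then show ?thesis
      using qpoch_reverse[of q "b * q powi (int M - int m)" m] q b
      by (simp add: W_def T_def L_def neg power_mult_distrib)
  qed
  have E: "qpoch (q powi (1 + int M - int m)) q m = s * q ^ m * L * T * Z"
  proof -
    have 1: "q powi (1 + int M - int m) = q * q powi (int M - int m)"
      using q by (simp add: power_int_diff power_int_add)
    have "q powi (1 - int m) / q powi (1 + int M - int m) = q powi (- int M)"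
      using q by (simp add: power_int_diff power_int_add power_int_minus field_simps)
    then show ?thesis
      using qpoch_reverse[of q "q powi (1 + int M - int m)" m] q
      by (simp add: Z_def T_def L_def neg power_mult_distrib 1)
  qed
  \<comment> \<open>These two factors cancel \<open>qpochi b q (int m - 1)\<close> and
    \<open>1 - b / q\<close> in the denominators of \<open>R_coeff_norm\<close>.\<close>
  have C: "qpoch (b * inverse q) q m = qpochi b q (int m - 1) * (1 - b / q)"
  proof -
    have "qpochi b q (- 1) * (1 - b / q) = 1"
      using qpochi_add_1[of "- 1"] by (simp add: power_int_minus field_simps)
    then have "1 / qpochi b q (- 1) = 1 - b / q"
      using qpochi_nonzero[of "- 1"] by (simp add: field_simps)
    moreover have "qpoch (b * inverse q) q m = qpochi b q (int m - 1) * (1 / qpochi b q (- 1))"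
      using qpoch_eq_qpochi[of "- 1" m] by (simp add: power_int_minus)
    ultimately show ?thesis by simp
  qed
  have G: "qpoch b q M = qpochi b q (int M)"
    using qpoch_eq_qpochi[of 0 M] by simp
  have "1 - b / q \<noteq> 0"
    using factor_nonzero[of "- 1"] by (simp add: power_int_minus field_simps)
  \<comment> \<open>This matches the quadratic power of \<open>q\<close> with the two copies of
    \<open>T\<close> in \<open>X * X\<close>.\<close>
  moreover have T: "(q ^ m) ^ m = T\<^sup>2 * q ^ m"
    by (simp add: T_def prod_powers_squared power_mult)
  ultimately have "qpoch (q powi (- int m)) q m * qpoch (b * inverse q) q m
       / (qpoch (b * q powi (int M - int m)) q m * qpoch q q m)
       * (\<Sum>j\<le>m. R_summand M m m j) / qpoch b q M
     = Y * (Y * Y) * (q ^ m * (T\<^sup>2 * q ^ m)) * (s * q ^ m * L * T * Z) / ((s * b ^ m * L * T * W) * (X * X) * V)"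
    unfolding R_coeff_norm[OF assms] C D E G T qcoeff_def X_def[symmetric] Y_def[symmetric] V_def[symmetric]
    using qpochi_nonzero[of "int M"] qpochi_nonzero[of "int m - 1"] q(1) by simp
  also have "X * X = (q ^ m * q ^ m) * T\<^sup>2 * (Y * Y)"
    using s by (simp add: X power2_eq_square)
  \<comment> \<open>On the right \<open>s\<close> and \<open>T\<close> are put back above and below
    to form \<open>X\<close> and \<open>qpoch b q m\<close>.\<close>
  also have "Y * (Y * Y) * (q ^ m * (T\<^sup>2 * q ^ m)) * (s * q ^ m * L * T * Z)
      / ((s * b ^ m * L * T * W) * ((q ^ m * q ^ m) * T\<^sup>2 * (Y * Y)) * V)
    = Z * (s * q ^ m * T * Y) / (W * (s * b ^ m * T * V))"
    using nz s q b by (simp add: field_simps)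
  also have "\<dots> = pastro_norm (q powi (- int M)) b q m"
  proof -
    have "q powi (- int M) * inverse b * q = q powi (1 - int M) / b"
      using q by (simp add: power_int_diff power_int_minus field_simps)
    then show ?thesis
      unfolding pastro_norm_def X[symmetric] B[symmetric] by (simp add: X_def Z_def W_def)
  qed
  finally show ?thesis .
qed

section \<open>Expansion in powers of \<open>x\<close> and assembly\<close>

text \<open>The ratio of \<open>qpoch q q n\<close> to \<open>qpoch (q powi (- int n)) q n\<close>
  is \<open>1 / qcoeff q n n\<close>, so the prefactor is the reciprocal of the coefficient of
  \<open>x ^ n\<close> in the sum.\<close>

lemma pastro_P_expansion:
  "pastro_P (q powi (- int M)) b q n x
     = qpoch (b * q powi (1 + int M - int n)) q n / (qcoeff q n n * qpoch b q n)
       * (\<Sum>k\<le>n. qcoeff q n k * qpoch b q k / qpoch (b * q powi (1 + int M - int n)) q k * x ^ k)"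
proof -
  have "q powi (1 + int M - int n) = q powi int M * q powi (1 - int n)"
    using q by (simp add: power_int_diff power_int_add)
  then have param: "inverse (q powi (- int M)) * b * q powi (1 - int n) = b * q powi (1 + int M - int n)"
    by (simp add: power_int_minus)
  show ?thesis
    unfolding pastro_P_def param phi21_def qcoeff_def atLeast0AtMost by (simp add: mult_ac)
qed

lemma pastro_R_expansion:
  "pastro_R (q powi (- int M)) b q m x
     = qpoch (q powi (- int m)) q m * qpoch (b * inverse q) q m
         / (qpoch (b * q powi (int M - int m)) q m * qpoch q q m)
       * (\<Sum>j\<le>m. qcoeff q m j * qpoch (q powi (1 - int M) / b) q j / qpoch (q powi (2 - int m) / b) q j
            * (q ^ (M + 2)) ^ j * (inverse x) ^ j)"
proof -
  have 1: "inverse (q powi (- int M)) * b * q powi (- int m) = b * q powi (int M - int m)"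
    using q by (simp add: power_int_diff power_int_minus divide_inverse)
  have 2: "q powi (- int M) * inverse b * q = q powi (1 - int M) / b"
    using q by (simp add: power_int_diff power_int_minus field_simps)
  have 3: "inverse b * q powi (2 - int m) = q powi (2 - int m) / b"
    by (simp add: divide_inverse)
  have 4: "q ^ 2 / (q powi (- int M) * x) = q ^ (M + 2) * inverse x"
    using q by (simp add: power_int_minus power_add power2_eq_square divide_inverse)
  show ?thesis
    unfolding pastro_R_def 1 2 3 4 phi21_def qcoeff_def atLeast0AtMost
    by (simp add: power_mult_distrib mult_ac)
qed

lemma pastro_biorthogonal:
  assumes "n \<le> M" "m \<le> M"
  shows "(\<Sum>s<Suc M. pastro_weight (Suc M) b q s * pastro_P (q powi (- int M)) b q n (pastro_grid q s)
                   * pastro_R (q powi (- int M)) b q m (pastro_grid q s))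
         = (if m = n then pastro_norm (q powi (- int M)) b q n else 0)"
proof -
  define p where "p k = qcoeff q n k * qpoch b q k / qpoch (b * q powi (1 + int M - int n)) q k" for k
  define r where "r j = qcoeff q m j * qpoch (q powi (1 - int M) / b) q j
      / qpoch (q powi (2 - int m) / b) q j * (q ^ (M + 2)) ^ j" for j
  define \<mu> where "\<mu> e = q powi e * qpoch (b * q powi e) q M" for e
  define cP where "cP = qpoch (b * q powi (1 + int M - int n)) q n / (qcoeff q n n * qpoch b q n)"
  define cR where "cR = qpoch (q powi (- int m)) q m * qpoch (b * inverse q) q m
         / (qpoch (b * q powi (int M - int m)) q m * qpoch q q m)"
  define x where "x = pastro_grid q"
  define w where "w = pastro_weight (Suc M) b q"
  have R: "R_summand M m k j = r j * \<mu> (int k - int j)" for k j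
    by (simp add: R_summand_def r_def \<mu>_def)
  \<comment> \<open>This says that \<open>P_n\<close> is monic.\<close>
  have "cP * p n = 1"
  proof -
    have "qcoeff q n n \<noteq> 0"
      using qpoch_neg_power_nonzero[OF q] qpoch_self_nonzero[OF q(2,3)] by (simp add: qcoeff_def)
    moreover have "qpoch b q n \<noteq> 0"
      using qpoch_shift_nonzero[of 0 n] by simp
    ultimately show ?thesis
      using qpoch_shift_nonzero by (simp add: cP_def p_def)
  qed
  have "w s * pastro_P (q powi (- int M)) b q n (x s) * pastro_R (q powi (- int M)) b q m (x s)
      = cP * cR * (\<Sum>k\<le>n. \<Sum>j\<le>m. p k * r j * (w s * x s powi (int k - int j)))" for s
  proof -
    have "x s \<noteq> 0" using q by (simp add: x_def pastro_grid_def)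
    then have "x s powi (int k - int j) = x s ^ k * inverse (x s) ^ j" for k j
      by (simp add: power_int_diff power_inverse divide_inverse)
    moreover have "(\<Sum>k\<le>n. p k * x s ^ k) * (\<Sum>j\<le>m. r j * inverse (x s) ^ j)
       = (\<Sum>k\<le>n. \<Sum>j\<le>m. p k * x s ^ k * (r j * inverse (x s) ^ j))"
      by (rule sum_product)
    ultimately show ?thesis
      unfolding pastro_P_expansion pastro_R_expansion p_def[symmetric] r_def[symmetric]
        cP_def[symmetric] cR_def[symmetric]
      by (simp add: sum_distrib_left mult_ac)
  qed
  then have "(\<Sum>s<Suc M. w s * pastro_P (q powi (- int M)) b q n (x s) * pastro_R (q powi (- int M)) b q m (x s))
      = cP * cR * (\<Sum>s<Suc M. \<Sum>k\<le>n. \<Sum>j\<le>m. p k * r j * (w s * x s powi (int k - int j)))"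
    by (simp only: sum_distrib_left)
  \<comment> \<open>The grid sum is moved innermost, where \<open>moment\<close> evaluates
    it.\<close>
  also have "(\<Sum>s<Suc M. \<Sum>k\<le>n. \<Sum>j\<le>m. p k * r j * (w s * x s powi (int k - int j)))
      = (\<Sum>k\<le>n. \<Sum>j\<le>m. \<Sum>s<Suc M. p k * r j * (w s * x s powi (int k - int j)))"
    by (subst sum.swap, intro sum.cong refl sum.swap)
  also have "\<dots> = (\<Sum>k\<le>n. \<Sum>j\<le>m. p k * r j * \<mu> (int k - int j)) / qpoch b q M"
    unfolding sum_distrib_left[symmetric] w_def x_def moment \<mu>_def
    by (simp add: sum_divide_distrib)
  also have "cP * cR * ((\<Sum>k\<le>n. \<Sum>j\<le>m. p k * r j * \<mu> (int k - int j)) / qpoch b q M)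
      = (if m = n then pastro_norm (q powi (- int M)) b q n else 0)"
  proof (cases "m < n")
    case True
    \<comment> \<open>Every \<open>j \<le> m\<close> is below \<open>n\<close>, so the sum over
      \<open>k\<close> is taken first and vanishes for each \<open>j\<close>.\<close>
    have "(\<Sum>k\<le>n. \<Sum>j\<le>m. p k * r j * \<mu> (int k - int j)) = (\<Sum>j\<le>m. r j * (\<Sum>k\<le>n. p k * \<mu> (int k - int j)))"
      by (subst sum.swap) (simp add: sum_distrib_left mult_ac)
    also have "\<dots> = 0"
      using P_coeff_orthogonal[OF assms(1)] True by (intro sum.neutral) (simp add: p_def \<mu>_def)
    finally show ?thesis using True by simp
  next
    case False
    \<comment> \<open>Now \<open>n \<le> m\<close>, so \<open>R_m\<close> annihilates
      \<open>x ^ k\<close> for \<open>k < n\<close>. Only the split-off term \<open>k = n\<close>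
      can survive, and it vanishes too when \<open>n < m\<close>.\<close>
    have sum: "(\<Sum>k\<le>n. \<Sum>j\<le>m. p k * r j * \<mu> (int k - int j))
      = (\<Sum>k<n. p k * (\<Sum>j\<le>m. R_summand M m k j)) + p n * (\<Sum>j\<le>m. R_summand M m n j)"
      by (simp only: R mult.assoc sum_distrib_left[symmetric] lessThan_Suc_atMost[symmetric, of n] sum.lessThan_Suc)
    have 0: "(\<Sum>k<n. p k * (\<Sum>j\<le>m. R_summand M m k j)) = 0"
      using False R_coeff_orthogonal by (intro sum.neutral) auto
    show ?thesis
    proof (cases "m = n")
      case True
      have "cP * cR * (p n * (\<Sum>j\<le>m. R_summand M m n j) / qpoch b q M)
        = cP * p n * (cR * (\<Sum>j\<le>m. R_summand M m m j) / qpoch b q M)"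
        using True by simp
      also have "\<dots> = pastro_norm (q powi (- int M)) b q m"
        unfolding \<open>cP * p n = 1\<close> cR_def R_norm[OF assms(2)] by simp
      finally show ?thesis unfolding sum 0 using True by simp
    next
      case neq: False
      then show ?thesis using False R_coeff_orthogonal[of n m M] by (simp add: sum 0)
    qed
  qed
  finally show ?thesis unfolding w_def x_def .
qed

end

theorem proposition5p1:
  fixes q a b :: real and N m n :: nat
  assumes "q \<noteq> 0" and "q \<noteq> 1" and "q \<noteq> -1"
    and "N \<ge> 1"
    and "b \<noteq> 0" and "\<And>k :: int. b \<noteq> q powi k"
    and "a = q powi (1 - int N)"
    and "m < N" and "n < N"
  shows "(\<Sum>s<N. pastro_weight N b q s * pastro_P a b q n (pastro_grid q s)
                   * pastro_R a b q m (pastro_grid q s))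
         = (if m = n then pastro_norm a b q n else 0)"
proof -
  obtain M where M: "N = Suc M" using assms(4) by (cases N) auto
  then have "1 - int N = - int M" by simp
  then show ?thesis
    unfolding assms(7) using pastro_biorthogonal[OF assms(1-3,5,6), of n M m] assms(8,9)
    by (simp only: M less_Suc_eq_le)
qed

end
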